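(* Assume (a), (b) (for every dataset $z$), (d) and (e) for the algorithm $P^{(Q,\lambda)}_{\Theta|Z}$. Then $$\bar{\bar G}\big(P^{(Q,\lambda)}_{\Theta|Z},P_Z\big)=\lambda\int\Big(\int\dot f\Big(\frac{dP^{(Q,\lambda)}_{\Theta|Z=z}}{dQ}(\theta)\Big)dP^{(Q,\lambda)}_{\Theta|Z=z}(\theta)-\int\dot f\Big(\frac{dP^{(Q,\lambda)}_{\Theta|Z=z}}{dQ}(\theta)\Big)dP^{(Q,\lambda)}_{\Theta}(\theta)\Big)dP_Z(z).$$
   Context: Setting. - $\mathcal{M}\subseteq\mathbb{R}^d$; $h:\mathcal{M}\times\mathcal{X}\to\mathcal{Y}$; the loss $\ell:\mathcal{Y}\times\mathcal{Y}\to[0,\infty)$ satisfies $\ell(y,y)=0$. - For a dataset $z\in(\mathcal{X}\times\mathcal{Y})^n$, $L_z(\theta)=\frac1n\sum_i\ell(h(\theta,x_i),y_i)$ and $R_z(P)=\int L_z\,dP$. - $Q$ is a Borel probability measure on $\mathcal{M}$, and $\triangle_Q(\mathcal{M})$ is the set of probability measures $P\ll Q$. Fix $\lambda>0$. - $f:[0,\infty)\to\mathbb{R}$ is convex with $f(1)=0$; $D_f(P\|Q)=\int f(\frac{dP}{dQ})dQ$. - $\dot f$ is the derivative of $f$ on $(0,\infty)$ and $\dot f^{-1}$ its inverse. Assumptions. - (a) $f$ is strictly convex and differentiable. - (b) For the given $z$, there exists $\beta$ with $\dot f^{-1}\big(-\frac{\beta+L_z(\theta)}{\lambda}\big)>0$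 on $\operatorname{supp}Q$ and $\int\dot f^{-1}\big(-\frac{\beta+L_z(\theta)}{\lambda}\big)dQ=1$. The algorithm. - $P^{(Q,\lambda)}_{\Theta|Z=z}$ is the unique minimizer of $R_z(P)+\lambda D_f(P\|Q)$ over $\triangle_Q(\mathcal{M})$, with density $\frac{dP^{(Q,\lambda)}_{\Theta|Z=z}}{dQ}(\theta)=\dot f^{-1}\big(-\frac{\beta+L_z(\theta)}{\lambda}\big)$. - $P_Z$ is a probability measure on $(\mathcal{X}\times\mathcal{Y})^n$. - $P^{(Q,\lambda)}_{\Theta|Z}$ is the algorithm $z\mapsto P^{(Q,\lambda)}_{\Theta|Z=z}$. - $P^{(Q,\lambda)}_\Theta(\mathcal{C})=\int P^{(Q,\lambda)}_{\Theta|Z=z}(\mathcal{C})\,dP_Z(z)$. Generalization error. For an algorithm $P_{\Theta|Z}$ with marginal $P_\Theta(\mathcal{C})=\int P_{\Theta|Z=z}(\mathcal{C})dP_Z(z)$, $$\bar{\bar G}(P_{\Theta|Z},P_Z)=\int\!\int\big(R_u(P_{\Theta|Z=z})-R_z(P_{\Theta|Z=z})\big)dP_Z(u)\,dP_Z(z).$$ Further assumptions. - (d) For all $z$, $P_{\Theta|Z=z}\ll P_\Theta$ and $P_\Theta\in\triangle_Q(\mathcal{M})$. - (e) $P_\Theta$ and $Q$ are mutually absolutely continuous. *)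

theory Defs
  imports "HOL-Probability.Probability"
begin

definition strictly_convex_on :: "real set \<Rightarrow> (real \<Rightarrow> real) \<Rightarrow> bool" where
  "strictly_convex_on A f \<longleftrightarrow> convex A \<and>
     (\<forall>x\<in>A. \<forall>y\<in>A. \<forall>t::real. x \<noteq> y \<and> 0 < t \<and> t < 1 \<longrightarrow>
        f (t * x + (1 - t) * y) < t * f x + (1 - t) * f y)"

definition emp_loss :: "('y \<Rightarrow> 'y \<Rightarrow> real) \<Rightarrow> ('m \<Rightarrow> 'x \<Rightarrow> 'y) \<Rightarrow> ('x \<times> 'y) list \<Rightarrow> 'm \<Rightarrow> real" where
  "emp_loss loss h z \<theta> = (\<Sum>p\<leftarrow>z. loss (h \<theta> (fst p)) (snd p)) / real (length z)"

definition emp_risk :: "('y \<Rightarrow> 'y \<Rightarrow> real) \<Rightarrow> ('m \<Rightarrow> 'x \<Rightarrow> 'y) \<Rightarrow> ('x \<times> 'y) list \<Rightarrow> 'm measure \<Rightarrow> real" where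
  "emp_risk loss h z P = (\<integral>\<theta>. emp_loss loss h z \<theta> \<partial>P)"

definition fdot_inv :: "(real \<Rightarrow> real) \<Rightarrow> real \<Rightarrow> real" where
  "fdot_inv f = the_inv_into {0<..} (deriv f)"

text \<open>Density of the f-divergence regularised Gibbs-type algorithm w.r.t. Q.\<close>
definition gibbs_density :: "(real \<Rightarrow> real) \<Rightarrow> ('y \<Rightarrow> 'y \<Rightarrow> real) \<Rightarrow> ('m \<Rightarrow> 'x \<Rightarrow> 'y) \<Rightarrow> real \<Rightarrow> real
      \<Rightarrow> ('x \<times> 'y) list \<Rightarrow> 'm \<Rightarrow> real" where
  "gibbs_density f loss h lam b z \<theta> = fdot_inv f (- (b + emp_loss loss h z \<theta>) / lam)"

definition gibbs_alg :: "'m measure \<Rightarrow> (real \<Rightarrow> real) \<Rightarrow> ('y \<Rightarrow> 'y \<Rightarrow> real) \<Rightarrow> ('m \<Rightarrow> 'x \<Rightarrow> 'y) \<Rightarrow> real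
      \<Rightarrow> (('x \<times> 'y) list \<Rightarrow> real) \<Rightarrow> ('x \<times> 'y) list \<Rightarrow> 'm measure" where
  "gibbs_alg Q f loss h lam \<beta> z = density Q (\<lambda>\<theta>. ennreal (gibbs_density f loss h lam (\<beta> z) z \<theta>))"

definition marginal :: "'m measure \<Rightarrow> 'd measure \<Rightarrow> ('d \<Rightarrow> 'm measure) \<Rightarrow> 'm measure" where
  "marginal Q PZ P = measure_of (space Q) (sets Q) (\<lambda>C. \<integral>\<^sup>+ z. emeasure (P z) C \<partial>PZ)"

definition gen_error :: "('y \<Rightarrow> 'y \<Rightarrow> real) \<Rightarrow> ('m \<Rightarrow> 'x \<Rightarrow> 'y) \<Rightarrow> (('x \<times> 'y) list \<Rightarrow> 'm measure)
      \<Rightarrow> ('x \<times> 'y) list measure \<Rightarrow> real" where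
  "gen_error loss h P PZ =
     (\<integral>z. (\<integral>u. (emp_risk loss h u (P z) - emp_risk loss h z (P z)) \<partial>PZ) \<partial>PZ)"

definition measure_support :: "('m::topological_space) measure \<Rightarrow> 'm set" where
  "measure_support Q = {\<theta> \<in> space Q. \<forall>U. open U \<and> \<theta> \<in> U \<longrightarrow> emeasure Q (U \<inter> space Q) > 0}"

definition prob_abs_cont :: "'m measure \<Rightarrow> 'm measure set" where
  "prob_abs_cont Q = {P. prob_space P \<and> sets P = sets Q \<and> absolutely_continuous Q P}"

end

(*
  The stationarity condition f'(dP_z/dQ) = - (beta_z + L_z) / lambda holds Q-almost everywhere, hence
  also almost everywhere for P_z and for the marginal. The constants beta_z cancel in the difference
  of the two inner integrals, which becomes (R_z(P_Theta) - R_z(P_z)) / lambda, and Fubini identifies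
  the mean of R_z(P_Theta) with the mean test risk.

  The delicate point is the null set of datasets z for which L_z is not integrable w.r.t. the marginal:
  there the integrand depends on beta_z, and it still has to be measurable in z. This follows because
  the law of dP_z/dQ under Q is a measurable function of z: the integral of (dP_z/dQ - a)^+ is the
  supremum of P_z(C) - a Q(C) over a countable class of sets C.
*)
theory Submission
  imports Defs
begin

section \<open>Strictly convex functions and supports of measures\<close>

text \<open>The tangent at \<open>x\<close>, evaluated at the midpoint, bounds half of f'(x)(y - x)
  by f(mid) - f(x), which strict convexity makes smaller than half of f(y) - f(x). The tangent at
  \<open>y\<close>, evaluated at \<open>x\<close>, bounds f(y) - f(x) by f'(y)(y - x).\<close>

lemma strictly_convex_deriv_less:
  fixes f :: "real \<Rightarrow> real"
  assumes sc: "strictly_convex_on {0..} f" and diff: "\<forall>x>0. f differentiable (at x)"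
    and xy: "0 < x" "x < y"
  shows "deriv f x < deriv f y"
proof -
  have cvx: "convex_on {0<..} f"
  proof (rule convex_onI)
    fix t u v :: real assume *: "0 < t" "t < 1" "u \<in> {0<..}" "v \<in> {0<..}"
    show "f ((1 - t) *\<^sub>R u + t *\<^sub>R v) \<le> (1 - t) * f u + t * f v"
    proof (cases "u = v")
      case True
      then show ?thesis by (simp add: algebra_simps)
    next
      case False
      then have "f (t * v + (1 - t) * u) < t * f v + (1 - t) * f u"
        using sc * unfolding strictly_convex_on_def by auto
      then show ?thesis by (simp add: add.commute)
    qed
  qed simp
  have tangent: "f u - f v \<ge> deriv f v * (u - v)" if "0 < u" "0 < v" for u v
  proof (rule convex_on_imp_above_tangent[OF cvx])
    have "(f has_real_derivative deriv f v) (at v)"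
      using diff that by (simp add: DERIV_deriv_iff_real_differentiable)
    then show "(f has_real_derivative deriv f v) (at v within {0<..})"
      by (rule has_field_derivative_at_within)
  qed (use that in \<open>auto simp: interior_open\<close>)
  have "f ((1/2) * x + (1 - 1/2) * y) < (1/2) * f x + (1 - 1/2) * f y"
    using sc xy unfolding strictly_convex_on_def
    by (elim conjE ballE[where x = x] ballE[where x = y] allE[where x = "1/2"]) auto
  moreover have "f ((1/2) * x + (1 - 1/2) * y) - f x \<ge> deriv f x * ((1/2) * x + (1 - 1/2) * y - x)"
    by (rule tangent) (use xy in auto)
  moreover have "f x - f y \<ge> deriv f y * (x - y)"
    by (rule tangent) (use xy in auto)
  ultimately have "deriv f x * (y - x) < deriv f y * (y - x)"
    by (simp add: algebra_simps field_simps)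
  then show ?thesis
    using xy by simp
qed

text \<open>Points off the support lie in open null sets, and by Lindelof countably many of these
  cover them all. Assumption (b) speaks of the support only; this turns it into a statement Q-almost
  everywhere.\<close>

lemma AE_measure_support:
  fixes Q :: "'a::second_countable_topology measure"
  assumes "sets Q = sets (restrict_space borel M)"
  shows "AE x in Q. x \<in> measure_support Q"
proof -
  have sp: "space Q = M"
    using sets_eq_imp_space_eq[OF assms] by (simp add: space_restrict_space)
  have meas: "U \<inter> M \<in> sets Q" if "open U" for U
    using that by (auto simp: assms sets_restrict_space)
  define \<F> where "\<F> = {U. open U \<and> emeasure Q (U \<inter> M) = 0}"
  obtain \<F>' where \<F>': "\<F>' \<subseteq> \<F>" "countable \<F>'" "\<Union>\<F>' = \<Union>\<F>"
    by (rule Lindelof[of \<F>]) (auto simp: \<F>_def)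
  have "(\<Union>U\<in>\<F>'. U \<inter> M) \<in> null_sets Q"
    using \<F>' meas by (intro null_sets_UN') (auto simp: \<F>_def null_sets_def)
  moreover have "{x \<in> space Q. x \<notin> measure_support Q} \<subseteq> (\<Union>U\<in>\<F>'. U \<inter> M)"
  proof
    fix x assume "x \<in> {x \<in> space Q. x \<notin> measure_support Q}"
    then have "x \<in> M" "x \<in> \<Union>\<F>"
      by (auto simp: measure_support_def \<F>_def sp)
    then show "x \<in> (\<Union>U\<in>\<F>'. U \<inter> M)"
      using \<F>'(3) by blast
  qed
  ultimately show ?thesis
    by (rule AE_I')
qed

section \<open>Measurable dependence of the law of a density on a parameter\<close>

text \<open>Regularity encloses the set between a compact \<open>K\<close> and an open
  \<open>U\<close> with \<open>U - K\<close> small. \<open>U\<close> is a union of basis sets,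
  finitely many of which cover \<open>K\<close>; their union lies between \<open>K\<close> and
  \<open>U\<close>, so it differs from the set only inside \<open>U - K\<close>.\<close>

lemma finite_measure_approx_basis:
  fixes N :: "'a::{second_countable_topology, complete_space} measure"
  assumes "finite_measure N" and sets: "sets N = sets (restrict_space borel M)"
    and B: "B \<in> sets N" and "e > 0" and basis: "topological_basis \<B>"
  obtains F where "finite F" "F \<subseteq> \<B>" "measure N (sym_diff (\<Union>F \<inter> M) B) < e"
proof -
  interpret finite_measure N by fact
  have sp: "space N = M"
    using sets_eq_imp_space_eq[OF sets] by (simp add: space_restrict_space)
  have meas: "A \<inter> M \<in> sets N" if "A \<in> sets borel" for A
    using that by (auto simp: sets sets_restrict_space)
  obtain B' where B': "B' \<in> sets borel" "B = B' \<inter> M"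
    using B by (auto simp: sets sets_restrict_space)
  \<comment> \<open>Regularity concerns measures on the full Borel sigma-algebra, whereas
    \<open>M\<close> is arbitrary and need not be Borel; hence the push-forward along the
    inclusion.\<close>
  define \<nu> where "\<nu> = distr N borel (\<lambda>x. x)"
  have id: "(\<lambda>x. x) \<in> measurable N borel"
    by (rule measurableI) (use meas sp in auto)
  interpret \<nu>: finite_measure \<nu>
    unfolding \<nu>_def by (rule finite_measure_distr[OF id])
  have \<nu>: "emeasure \<nu> A = emeasure N (A \<inter> M)" if "A \<in> sets borel" for A
    using that unfolding \<nu>_def by (subst emeasure_distr[OF id]) (auto simp: sp)
  have \<nu>_sets: "sets \<nu> = sets borel" by (simp add: \<nu>_def)
  have fin: "emeasure \<nu> (space \<nu>) \<noteq> \<infinity>" by simp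
  have \<nu>_lt: "emeasure \<nu> B' < emeasure \<nu> B' + ennreal (e/2)"
    using \<open>e > 0\<close> by (simp add: \<nu>.emeasure_eq_measure ennreal_less_iff flip: ennreal_plus)
  then have "(INF U \<in> {U. B' \<subseteq> U \<and> open U}. emeasure \<nu> U) < emeasure \<nu> B' + ennreal (e/2)"
    using outer_regular[OF \<nu>_sets fin B'(1)] by simp
  then obtain U where U: "B' \<subseteq> U" "open U" "emeasure \<nu> U < emeasure \<nu> B' + ennreal (e/2)"
    by (auto simp: INF_less_iff)
  \<comment> \<open>Otherwise the supremum over compact subsets plus e/2 would be at most
    \<open>emeasure \<nu> B'\<close>, which by inner regularity is that supremum itself and is
    finite.\<close>
  have "\<exists>K. K \<subseteq> B' \<and> compact K \<and> emeasure \<nu> B' < emeasure \<nu> K + ennreal (e/2)"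
  proof (rule ccontr)
    assume "\<not> ?thesis"
    then have "emeasure \<nu> K + ennreal (e/2) \<le> emeasure \<nu> B'" if "K \<subseteq> B'" "compact K" for K
      using that by (meson not_le)
    then have "(SUP K\<in>{K. K \<subseteq> B' \<and> compact K}. emeasure \<nu> K + ennreal (e/2)) \<le> emeasure \<nu> B'"
      by (intro SUP_least) auto
    moreover have "(SUP K\<in>{K. K \<subseteq> B' \<and> compact K}. emeasure \<nu> K + ennreal (e/2))
        = (SUP K\<in>{K. K \<subseteq> B' \<and> compact K}. emeasure \<nu> K) + ennreal (e/2)"
      by (intro ennreal_SUP_add_left) auto
    ultimately show False
      using \<nu>_lt inner_regular[OF \<nu>_sets fin B'(1)] by (simp add: not_le[symmetric])
  qed
  then obtain K where K: "K \<subseteq> B'" "compact K" "emeasure \<nu> B' < emeasure \<nu> K + ennreal (e/2)"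
    by blast
  obtain \<B>' where \<B>': "\<B>' \<subseteq> \<B>" "U = \<Union>\<B>'"
    using basis U(2) unfolding topological_basis_def by metis
  have "K \<subseteq> \<Union>\<B>'" "\<And>V. V \<in> \<B>' \<Longrightarrow> open V"
    using K U \<B>' topological_basis_open[OF basis] by blast+
  then obtain F where F: "F \<subseteq> \<B>'" "finite F" "K \<subseteq> \<Union>F"
    using compactE[OF K(2)] by metis
  have Kb: "K \<in> sets borel" and Ub: "U \<in> sets borel"
    using K(2) U(2) by (auto intro: borel_compact)
  have "measure \<nu> U < measure \<nu> B' + e/2" "measure \<nu> B' < measure \<nu> K + e/2"
    using U(3) K(3) \<open>e > 0\<close>
    by (simp_all add: \<nu>.emeasure_eq_measure ennreal_less_iff flip: ennreal_plus)
  moreover have "measure \<nu> (U - K) = measure \<nu> U - measure \<nu> K"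
    using Kb Ub K U by (intro \<nu>.finite_measure_Diff) (auto simp: \<nu>_sets)
  ultimately have "measure \<nu> (U - K) < e" by linarith
  moreover have "measure N (sym_diff (\<Union>F \<inter> M) B) \<le> measure N ((U - K) \<inter> M)"
    using F \<B>' K U B' meas Kb Ub by (intro finite_measure_mono) auto
  moreover have "measure N ((U - K) \<inter> M) = measure \<nu> (U - K)"
    using \<nu>[of "U - K"] Kb Ub by (simp add: measure_def)
  ultimately show thesis
    using that[of F] F \<B>' by auto
qed

text \<open>Among the integrals of \<open>g\<close> over measurable sets the one over {g > 0} is the
  largest, and that set is approximated by finite unions of basis sets in the finite measure |g| dQ.
  Negative integrals become 0 under \<open>ennreal\<close>, which is also the value for empty
  \<open>F\<close>.\<close>

lemma integral_positive_part_eq_SUP: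
  fixes Q :: "'a::{second_countable_topology, complete_space} measure" and g :: "'a \<Rightarrow> real"
  assumes sets: "sets Q = sets (restrict_space borel M)"
    and basis: "topological_basis \<B>" and g[measurable]: "integrable Q g"
  shows "ennreal (\<integral>x. max 0 (g x) \<partial>Q) =
    (SUP F\<in>{F. finite F \<and> F \<subseteq> \<B>}. ennreal (\<integral>x. g x * indicator (\<Union>F \<inter> M) x \<partial>Q))"
proof (rule antisym)
  have sp: "space Q = M"
    using sets_eq_imp_space_eq[OF sets] by (simp add: space_restrict_space)
  have meas: "\<Union>F \<inter> M \<in> sets Q" if "F \<subseteq> \<B>" for F
  proof -
    have "open (\<Union>F)"
      using that topological_basis_open[OF basis] by blast
    then show ?thesis
      by (auto simp: sets sets_restrict_space)
  qed
  have int_ind: "integrable Q (\<lambda>x. g x * indicator A x)" if "A \<in> sets Q" for A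
    using integrable_mult_indicator[OF that g] by (simp add: mult.commute)
  have int_max: "integrable Q (\<lambda>x. max 0 (g x))"
    using g by (intro integrable_max) auto
  show "(SUP F\<in>{F. finite F \<and> F \<subseteq> \<B>}. ennreal (\<integral>x. g x * indicator (\<Union>F \<inter> M) x \<partial>Q))
      \<le> ennreal (\<integral>x. max 0 (g x) \<partial>Q)"
  proof (rule SUP_least)
    fix F assume "F \<in> {F. finite F \<and> F \<subseteq> \<B>}"
    then have "\<Union>F \<inter> M \<in> sets Q" by (simp add: meas)
    then show "ennreal (\<integral>x. g x * indicator (\<Union>F \<inter> M) x \<partial>Q) \<le> ennreal (\<integral>x. max 0 (g x) \<partial>Q)"
      by (intro ennreal_leI integral_mono int_ind int_max) (auto split: split_indicator)
  qed
  define N where "N = density Q (\<lambda>x. ennreal \<bar>g x\<bar>)"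
  define B where "B = {x \<in> space Q. 0 < g x}"
  have B: "B \<in> sets Q" unfolding B_def by measurable
  have "finite_measure N"
  proof
    have "emeasure N (space N) = (\<integral>\<^sup>+x. ennreal \<bar>g x\<bar> \<partial>Q)"
      unfolding N_def by (subst emeasure_density) (auto intro!: nn_integral_cong)
    also have "\<dots> < \<infinity>"
      using g by (simp add: integrable_iff_bounded)
    finally show "emeasure N (space N) \<noteq> \<infinity>" by simp
  qed
  moreover have "sets N = sets (restrict_space borel M)"
    using sets by (simp add: N_def)
  moreover have "B \<in> sets N"
    using B by (simp add: N_def)
  ultimately have approx: "\<exists>F. finite F \<and> F \<subseteq> \<B> \<and> measure N (sym_diff (\<Union>F \<inter> M) B) < e" if "e > 0" for e
    using finite_measure_approx_basis[of N M B e \<B>] that basis by metis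
  have measN: "measure N A = (\<integral>x. \<bar>g x\<bar> * indicator A x \<partial>Q)" if A[measurable]: "A \<in> sets Q" for A
  proof -
    have "A \<subseteq> space Q" using sets.sets_into_space[OF A] .
    then have "measure N A = (\<integral>x. indicator A x \<partial>N)"
      by (simp add: N_def Int_absorb2)
    also have "\<dots> = (\<integral>x. \<bar>g x\<bar> * indicator A x \<partial>Q)"
      unfolding N_def by (subst integral_density) auto
    finally show ?thesis .
  qed
  show "ennreal (\<integral>x. max 0 (g x) \<partial>Q) \<le>
    (SUP F\<in>{F. finite F \<and> F \<subseteq> \<B>}. ennreal (\<integral>x. g x * indicator (\<Union>F \<inter> M) x \<partial>Q))"
    (is "_ \<le> ?S")
  proof (rule ennreal_le_epsilon)
    fix e :: real assume "e > 0"
    then obtain F where F: "finite F" "F \<subseteq> \<B>" "measure N (sym_diff (\<Union>F \<inter> M) B) < e"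
      using approx by blast
    let ?C = "\<Union>F \<inter> M"
    have "(\<integral>x. max 0 (g x) \<partial>Q) - (\<integral>x. g x * indicator ?C x \<partial>Q)
        = (\<integral>x. max 0 (g x) - g x * indicator ?C x \<partial>Q)"
      by (intro Bochner_Integration.integral_diff[symmetric] int_max int_ind meas F)
    also have "\<dots> \<le> (\<integral>x. \<bar>g x\<bar> * indicator (sym_diff ?C B) x \<partial>Q)"
    proof (intro integral_mono Bochner_Integration.integrable_diff int_max int_ind meas F)
      show "integrable Q (\<lambda>x. \<bar>g x\<bar> * indicator (sym_diff ?C B) x)"
        using integrable_mult_indicator[OF _ integrable_abs[OF g], of "sym_diff ?C B"] B meas F
        by (simp add: mult.commute sets.Diff sets.Un)
    qed (auto simp: B_def sp split: split_indicator)
    also have "\<dots> < e"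
      using F B meas by (subst measN[symmetric]) auto
    \<comment> \<open>Splitting \<open>ennreal\<close> over a sum needs nonnegative summands, hence
      the \<open>max 0\<close>; it disappears again because \<open>ennreal\<close> sends negative
      reals to 0.\<close>
    finally have "(\<integral>x. max 0 (g x) \<partial>Q) \<le> max 0 (\<integral>x. g x * indicator ?C x \<partial>Q) + e"
      by linarith
    then have "ennreal (\<integral>x. max 0 (g x) \<partial>Q) \<le> ennreal (max 0 (\<integral>x. g x * indicator ?C x \<partial>Q) + e)"
      by (rule ennreal_leI)
    also have "\<dots> = ennreal (max 0 (\<integral>x. g x * indicator ?C x \<partial>Q)) + ennreal e"
      using \<open>e > 0\<close> by (intro ennreal_plus) auto
    also have "ennreal (max 0 (\<integral>x. g x * indicator ?C x \<partial>Q)) = ennreal (\<integral>x. g x * indicator ?C x \<partial>Q)"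
      by (simp add: max_def ennreal_neg)
    also have "\<dots> \<le> ?S"
      using F by (intro SUP_upper) auto
    finally show "ennreal (\<integral>x. max 0 (g x) \<partial>Q) \<le> ?S + ennreal e"
      by (simp add: add_right_mono)
  qed
qed

text \<open>The supremum formula sees the density only through \<open>measure (K z)\<close> on fixed
  sets, which is measurable in \<open>z\<close> for a kernel. Nothing is assumed on how
  \<open>\<rho> z x\<close> varies with \<open>z\<close> for fixed \<open>x\<close>.\<close>

lemma measurable_integral_hinge:
  fixes Q :: "'a::polish_space measure" and \<rho> :: "'z \<Rightarrow> 'a \<Rightarrow> real"
  assumes "finite_measure Q" and sets: "sets Q = sets (restrict_space borel M)"
    and K: "K \<in> Z \<rightarrow>\<^sub>M subprob_algebra Q"
    and \<rho>: "\<And>z. z \<in> space Z \<Longrightarrow> integrable Q (\<rho> z)" "\<And>z. z \<in> space Z \<Longrightarrow> AE x in Q. 0 \<le> \<rho> z x"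
    and K_eq: "\<And>z. z \<in> space Z \<Longrightarrow> K z = density Q (\<lambda>x. ennreal (\<rho> z x))"
  shows "(\<lambda>z. \<integral>x. max 0 (\<rho> z x - a) \<partial>Q) \<in> borel_measurable Z"
proof -
  interpret finite_measure Q by fact
  obtain \<B> :: "'a set set" where \<B>: "countable \<B>" "topological_basis \<B>"
    using ex_countable_basis by blast
  define I where "I = {F. finite F \<and> F \<subseteq> \<B>}"
  have "countable I"
    unfolding I_def using \<B>(1) by (rule countable_Collect_finite_subset)
  have meas: "\<Union>F \<inter> M \<in> sets Q" if "F \<in> I" for F
  proof -
    have "open (\<Union>F)"
      using that topological_basis_open[OF \<B>(2)] by (auto simp: I_def)
    then show ?thesis
      by (auto simp: sets sets_restrict_space)
  qed
  have "(\<lambda>z. SUP F\<in>I. ennreal (measure (K z) (\<Union>F \<inter> M) - a * measure Q (\<Union>F \<inter> M))) \<in> borel_measurable Z"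
  proof (intro borel_measurable_SUP \<open>countable I\<close>)
    fix F assume "F \<in> I"
    then have [measurable]: "(\<lambda>z. measure (K z) (\<Union>F \<inter> M)) \<in> borel_measurable Z"
      unfolding measure_def using measurable_emeasure_kernel[OF K meas] by measurable
    show "(\<lambda>z. ennreal (measure (K z) (\<Union>F \<inter> M) - a * measure Q (\<Union>F \<inter> M))) \<in> borel_measurable Z"
      by measurable
  qed
  then have "(\<lambda>z. enn2real (SUP F\<in>I. ennreal (measure (K z) (\<Union>F \<inter> M) - a * measure Q (\<Union>F \<inter> M)))) \<in> borel_measurable Z"
    by measurable
  moreover have "(\<integral>x. max 0 (\<rho> z x - a) \<partial>Q) =
      enn2real (SUP F\<in>I. ennreal (measure (K z) (\<Union>F \<inter> M) - a * measure Q (\<Union>F \<inter> M)))"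
    if z: "z \<in> space Z" for z
  proof -
    note \<rho>z[measurable] = \<rho>(1)[OF z]
    have "ennreal (\<integral>x. max 0 (\<rho> z x - a) \<partial>Q) =
        (SUP F\<in>I. ennreal (\<integral>x. (\<rho> z x - a) * indicator (\<Union>F \<inter> M) x \<partial>Q))"
      unfolding I_def using \<rho>z by (intro integral_positive_part_eq_SUP[OF sets \<B>(2)]) simp
    also have "\<dots> = (SUP F\<in>I. ennreal (measure (K z) (\<Union>F \<inter> M) - a * measure Q (\<Union>F \<inter> M)))"
    proof (intro SUP_cong refl arg_cong[where f = ennreal])
      fix F assume "F \<in> I"
      then have C[measurable]: "\<Union>F \<inter> M \<in> sets Q" (is "?C \<in> _") by (rule meas)
      have "?C \<subseteq> space Q" using sets.sets_into_space[OF C] .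
      then have "measure (K z) ?C = (\<integral>x. indicator ?C x \<partial>K z)"
        by (simp add: K_eq[OF z] Int_absorb2)
      also have "\<dots> = (\<integral>x. \<rho> z x * indicator ?C x \<partial>Q)"
        unfolding K_eq[OF z] using \<rho>(2)[OF z] by (subst integral_density) auto
      finally have 1: "measure (K z) ?C = (\<integral>x. \<rho> z x * indicator ?C x \<partial>Q)" .
      have 2: "measure Q ?C = (\<integral>x. indicator ?C x \<partial>Q)"
        using \<open>?C \<subseteq> space Q\<close> by (simp add: Int_absorb2)
      have "integrable Q (\<lambda>x. \<rho> z x * indicator ?C x)"
        using integrable_mult_indicator[OF C \<rho>z] by (simp add: mult.commute)
      then show "(\<integral>x. (\<rho> z x - a) * indicator ?C x \<partial>Q) = measure (K z) ?C - a * measure Q ?C"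
        unfolding 1 2 using C by (simp add: left_diff_distrib Bochner_Integration.integral_diff emeasure_finite less_top[symmetric])
    qed
    finally show ?thesis
      by (metis enn2real_ennreal integral_nonneg_AE AE_I2 max.cobounded1)
  qed
  ultimately show ?thesis
    by (simp cong: measurable_cong)
qed

text \<open>
  No jointly measurable version of the density is needed: the tail function of its law is the
  right derivative of \<^term>\<open>\<lambda>a. - (\<integral>x. max 0 (\<rho> z x - a) \<partial>Q)\<close>.
\<close>

lemma measurable_distr_density:
  fixes Q :: "'a::polish_space measure" and \<rho> :: "'z \<Rightarrow> 'a \<Rightarrow> real"
  assumes "prob_space Q" and sets: "sets Q = sets (restrict_space borel M)"
    and K: "K \<in> Z \<rightarrow>\<^sub>M subprob_algebra Q"
    and \<rho>: "\<And>z. z \<in> space Z \<Longrightarrow> integrable Q (\<rho> z)" "\<And>z. z \<in> space Z \<Longrightarrow> AE x in Q. 0 \<le> \<rho> z x"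
    and K_eq: "\<And>z. z \<in> space Z \<Longrightarrow> K z = density Q (\<lambda>x. ennreal (\<rho> z x))"
  shows "(\<lambda>z. distr Q borel (\<rho> z)) \<in> Z \<rightarrow>\<^sub>M prob_algebra borel"
proof -
  interpret prob_space Q by fact
  have \<rho>_meas: "\<rho> z \<in> borel_measurable Q" if "z \<in> space Z" for z
    using \<rho>(1)[OF that] by (rule borel_measurable_integrable)
  have tail: "(\<lambda>z. emeasure (distr Q borel (\<rho> z)) {a<..}) \<in> borel_measurable Z" for a
  proof -
    define H where "H b z = (\<integral>x. max 0 (\<rho> z x - b) \<partial>Q)" for b z
    have [measurable]: "H b \<in> borel_measurable Z" for b
      unfolding H_def by (rule measurable_integral_hinge[OF finite_measure_axioms sets K \<rho> K_eq])
    \<comment> \<open>Difference quotients of the hinge function with steps to the right: they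
      vanish where \<open>\<rho> z x \<le> a\<close> and are eventually 1 where
      \<open>a < \<rho> z x\<close>, so the limit is the tail with strict inequality.\<close>
    have lim: "(\<lambda>k. real (Suc k) * (H a z - H (a + 1 / real (Suc k)) z)) \<longlonglongrightarrow> measure Q {x\<in>space Q. a < \<rho> z x}"
      if z: "z \<in> space Z" for z
    proof -
      note [measurable] = \<rho>_meas[OF z]
      have int: "integrable Q (\<lambda>x. max 0 (\<rho> z x - b))" for b
        using \<rho>(1)[OF z] by (intro integrable_max) auto
      define \<phi> where "\<phi> k x = real (Suc k) * (max 0 (\<rho> z x - a) - max 0 (\<rho> z x - (a + 1 / real (Suc k))))" for k x
      have "(\<lambda>k. \<integral>x. \<phi> k x \<partial>Q) \<longlonglongrightarrow> (\<integral>x. indicator {x\<in>space Q. a < \<rho> z x} x \<partial>Q)"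
      proof (rule integral_dominated_convergence[where w = "\<lambda>_. 1"])
        show "AE x in Q. (\<lambda>k. \<phi> k x) \<longlonglongrightarrow> indicator {x\<in>space Q. a < \<rho> z x} x"
        proof (rule AE_I2)
          fix x assume x: "x \<in> space Q"
          have "eventually (\<lambda>k. \<phi> k x = indicator {x\<in>space Q. a < \<rho> z x} x) sequentially"
          proof (cases "a < \<rho> z x")
            case True
            then have "eventually (\<lambda>k. 1 / real (Suc k) < \<rho> z x - a) sequentially"
              by (intro order_tendstoD(2)[OF LIMSEQ_Suc[OF lim_1_over_n]]) auto
            then show ?thesis
              by eventually_elim (use True x in \<open>auto simp: \<phi>_def max_def field_simps\<close>)
          next
            case False
            have "\<phi> k x = 0" for k
            proof -
              have "0 < 1 / real (Suc k)" by simp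
              then have "\<rho> z x - (a + 1 / real (Suc k)) \<le> 0" "\<rho> z x - a \<le> 0"
                using False by linarith+
              then show ?thesis
                unfolding \<phi>_def by (simp only: max_absorb1) simp
            qed
            then show ?thesis using False by simp
          qed
          then show "(\<lambda>k. \<phi> k x) \<longlonglongrightarrow> indicator {x\<in>space Q. a < \<rho> z x} x"
            by (rule tendsto_eventually)
        qed
        \<comment> \<open>The hinge is 1-Lipschitz in its threshold, so the constant 1 dominates
          every quotient.\<close>
        show "AE x in Q. norm (\<phi> k x) \<le> 1" for k
        proof (rule AE_I2)
          fix x
          have "\<bar>max 0 (\<rho> z x - a) - max 0 (\<rho> z x - (a + 1 / real (Suc k)))\<bar> \<le> 1 / real (Suc k)"
          proof -
            have bound: "\<bar>max 0 (y - a) - max 0 (y - (a + t))\<bar> \<le> t" if "0 < t" for y t :: real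
              using that by (auto simp: max_def abs_if)
            show ?thesis by (rule bound) simp
          qed
          then have "real (Suc k) * \<bar>max 0 (\<rho> z x - a) - max 0 (\<rho> z x - (a + 1 / real (Suc k)))\<bar>
              \<le> real (Suc k) * (1 / real (Suc k))"
            by (intro mult_left_mono) auto
          then show "norm (\<phi> k x) \<le> 1"
            by (simp add: \<phi>_def abs_mult del: of_nat_Suc)
        qed
      qed (auto simp: \<phi>_def)
      moreover have "(\<integral>x. \<phi> k x \<partial>Q) = real (Suc k) * (H a z - H (a + 1 / real (Suc k)) z)" for k
        unfolding \<phi>_def H_def using int by (simp del: of_nat_Suc)
      ultimately show ?thesis
        by (simp del: of_nat_Suc)
    qed
    have "(\<lambda>z. measure Q {x\<in>space Q. a < \<rho> z x}) \<in> borel_measurable Z"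
      by (rule borel_measurable_LIMSEQ_real[OF lim]) measurable
    then have "(\<lambda>z. ennreal (measure Q {x\<in>space Q. a < \<rho> z x})) \<in> borel_measurable Z"
      by measurable
    also have "?this \<longleftrightarrow> ?thesis"
      using \<rho>_meas by (intro measurable_cong)
        (auto simp: emeasure_distr emeasure_eq_measure vimage_def Int_def conj_commute)
    finally show ?thesis .
  qed
  show ?thesis
  \<comment> \<open>Open half-lines generate the Borel sets and are stable under intersection, so
    measurable tails suffice.\<close>
  proof (rule measurable_prob_algebra_generated[where G = "range greaterThan" and \<Omega> = UNIV])
    show "sets borel = sigma_sets UNIV (range (greaterThan :: real \<Rightarrow> _))"
      by (subst borel_Ioi) simp
    show "Int_stable (range (greaterThan :: real \<Rightarrow> _))"
    proof (rule Int_stableI_image)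
      show "\<exists>c\<in>UNIV. {a<..} \<inter> {b<..} = {c<..}" for a b :: real
        by (rule bexI[of _ "max a b"]) auto
    qed
  qed (use tail \<rho>_meas in \<open>auto intro!: prob_space_distr\<close>)
qed

section \<open>The marginal as a measure, and Borel measurability of the derivative\<close>

text \<open>\<open>measure_of\<close> returns the prescribed values only if they form a measure;
  here they do, being those of the monadic bind. The bind form gives access to iterated integration
  against the marginal.\<close>

lemma marginal_eq_bind:
  assumes K: "K \<in> Z \<rightarrow>\<^sub>M subprob_algebra Q" and "space Z \<noteq> {}"
  shows "marginal Q Z K = Z \<bind> K"
proof -
  have sets: "sets (Z \<bind> K) = sets Q"
    using K \<open>space Z \<noteq> {}\<close> by (intro sets_bind) (auto dest: sets_kernel)
  then have space: "space (Z \<bind> K) = space Q"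
    by (rule sets_eq_imp_space_eq)
  have "marginal Q Z K = measure_of (space Q) (sets Q) (emeasure (Z \<bind> K))"
    unfolding marginal_def
    by (intro measure_of_eq sets.space_closed)
       (simp add: sets.sigma_sets_eq emeasure_bind[OF \<open>space Z \<noteq> {}\<close> K])
  also have "\<dots> = Z \<bind> K"
    using measure_of_of_measure[of "Z \<bind> K"] by (simp add: sets space)
  finally show ?thesis .
qed

text \<open>The derivative is increasing on the positive half-line and monotone functions are Borel;
  the constant \<open>c\<close> covers the points where \<open>f\<close> need not be
  differentiable.\<close>

lemma borel_measurable_deriv_strictly_convex:
  fixes f :: "real \<Rightarrow> real"
  assumes "strictly_convex_on {0..} f" "\<forall>x>0. f differentiable (at x)"
  shows "(\<lambda>x. if 0 < x then deriv f x else c) \<in> borel_measurable borel"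
proof -
  have "mono_on {0<..} (deriv f)"
    by (intro mono_onI)
       (metis strictly_convex_deriv_less[OF assms] greaterThan_iff le_less)
  then have "deriv f \<in> borel_measurable (restrict_space borel {0<..})"
    by (rule borel_measurable_mono_on_fnc)
  then show ?thesis
    by (subst measurable_If_restrict_space_iff) (auto simp: greaterThan_def)
qed

text \<open>The hypotheses \<open>kernel\<close>, \<open>int1\<close>, \<open>int2\<close> and
  \<open>int3\<close> spell out the measurability and integrability that the iterated integrals of
  the generalization error presuppose. In \<open>b\<close>, membership in the image of
  \<open>deriv f\<close> says that the inverse is evaluated inside its domain.\<close>

theorem theorem6:
  fixes Q :: "'a::euclidean_space measure" and M :: "'a set"
    and PZ :: "('x \<times> 'y) list measure" and n :: nat
    and h :: "'a \<Rightarrow> 'x \<Rightarrow> 'y" and loss :: "'y \<Rightarrow> 'y \<Rightarrow> real"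
    and f :: "real \<Rightarrow> real" and lam :: real and \<beta> :: "('x \<times> 'y) list \<Rightarrow> real"
  defines "P \<equiv> gibbs_alg Q f loss h lam \<beta>"
    and "P\<Theta> \<equiv> marginal Q PZ (gibbs_alg Q f loss h lam \<beta>)"
  assumes Q: "prob_space Q" "space Q = M" "sets Q = sets (restrict_space borel M)"
    and PZ: "prob_space PZ" "n > 0" "space PZ = {z. length z = n}"
    and loss: "\<forall>y1 y2. loss y1 y2 \<ge> 0" "\<forall>y. loss y y = 0"
    and lam: "lam > 0"
    and f: "convex_on {0..} f" "f 1 = 0"
    and a: "strictly_convex_on {0..} f" "\<forall>x>0. f differentiable (at x)"
    and b: "\<forall>z\<in>space PZ.
              (\<forall>\<theta>\<in>measure_support Q.
                  - (\<beta> z + emp_loss loss h z \<theta>) / lam \<in> deriv f ` {0<..}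
                \<and> gibbs_density f loss h lam (\<beta> z) z \<theta> > 0)
              \<and> integrable Q (gibbs_density f loss h lam (\<beta> z) z)
              \<and> (\<integral>\<theta>. gibbs_density f loss h lam (\<beta> z) z \<theta> \<partial>Q) = 1"
    and d: "\<forall>z\<in>space PZ. absolutely_continuous P\<Theta> (P z)" "P\<Theta> \<in> prob_abs_cont Q"
    and e: "absolutely_continuous P\<Theta> Q"
    and kernel: "P \<in> PZ \<rightarrow>\<^sub>M subprob_algebra Q"
    and int1: "\<forall>z\<in>space PZ. \<forall>u\<in>space PZ. integrable (P u) (emp_loss loss h z)"
    and int2: "integrable (PZ \<Otimes>\<^sub>M PZ) (\<lambda>(z, u). emp_risk loss h u (P z))"
    and int3: "integrable PZ (\<lambda>z. emp_risk loss h z (P z))"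
  shows "gen_error loss h P PZ =
    lam * (\<integral>z. (\<integral>\<theta>. deriv f (enn2real (RN_deriv Q (P z) \<theta>)) \<partial>(P z))
                - (\<integral>\<theta>. deriv f (enn2real (RN_deriv Q (P z) \<theta>)) \<partial>P\<Theta>) \<partial>PZ)"
proof -
  interpret Q: prob_space Q by (rule Q(1))
  interpret PZ: prob_space PZ by (rule PZ(1))
  interpret PP: pair_prob_space PZ PZ ..
  define D where "D z = gibbs_density f loss h lam (\<beta> z) z" for z
  define L where "L z = emp_loss loss h z" for z
  \<comment> \<open>The first argument is the dataset in the loss, the second the training dataset;
    \<open>int2\<close> has them in the opposite order.\<close>
  define r where "r z u = emp_risk loss h z (P u)" for z u
  \<comment> \<open>\<open>F\<close> agrees with \<open>deriv f\<close> on the nonnegative reals,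
    where all values of \<open>enn2real\<close> lie, and is Borel on the whole line.\<close>
  define F where "F x = (if 0 < x then deriv f x else deriv f 0)" for x
  have F_meas[measurable]: "F \<in> borel_measurable borel"
    unfolding F_def by (rule borel_measurable_deriv_strictly_convex[OF a])
  define A where "A z = (\<integral>\<theta>. deriv f (enn2real (RN_deriv Q (P z) \<theta>)) \<partial>P z)" for z
  define B where "B z = (\<integral>\<theta>. deriv f (enn2real (RN_deriv Q (P z) \<theta>)) \<partial>P\<Theta>)" for z
  have deriv_F: "deriv f (enn2real x) = F (enn2real x)" for x
    by (simp add: F_def less_le)
  have D: "integrable Q (D z)" "(\<integral>\<theta>. D z \<theta> \<partial>Q) = 1" if "z \<in> space PZ" for z
    using b that by (auto simp: D_def)
  have D_meas[measurable]: "D z \<in> borel_measurable Q" if "z \<in> space PZ" for z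
    using D(1)[OF that] by (rule borel_measurable_integrable)
  have P_eq: "P z = density Q (\<lambda>\<theta>. ennreal (D z \<theta>))" for z
    by (simp add: P_def gibbs_alg_def D_def)
  have P_sets[measurable_cong]: "sets (P z) = sets Q" for z
    by (simp add: P_eq)
  have inj: "inj_on (deriv f) {0<..}"
    by (rule linorder_inj_onI') (use strictly_convex_deriv_less[OF a] in force)
  have AE_D: "AE \<theta> in Q. 0 < D z \<theta> \<and> F (D z \<theta>) = - (\<beta> z + L z \<theta>) / lam"
    if z: "z \<in> space PZ" for z
    using AE_measure_support[OF Q(3)]
  proof eventually_elim
    case (elim \<theta>)
    then have "- (\<beta> z + L z \<theta>) / lam \<in> deriv f ` {0<..}" and pos: "0 < D z \<theta>"
      using b z by (auto simp: L_def D_def)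
    \<comment> \<open>\<open>the_inv_into\<close> is a genuine inverse only on the range of
      \<open>deriv f\<close>, so the image membership is used here.\<close>
    then have "deriv f (D z \<theta>) = - (\<beta> z + L z \<theta>) / lam"
      unfolding D_def gibbs_density_def fdot_inv_def L_def by (intro f_the_inv_into_f[OF inj])
    with pos show ?case by (simp add: F_def)
  qed
  have D_nonneg: "AE \<theta> in Q. 0 \<le> D z \<theta>" if "z \<in> space PZ" for z
    using AE_D[OF that] by eventually_elim auto
  have P_prob: "prob_space (P z)" if z: "z \<in> space PZ" for z
  proof
    have "emeasure (P z) (space (P z)) = (\<integral>\<^sup>+\<theta>. ennreal (D z \<theta>) \<partial>Q)"
      using z unfolding P_eq by (subst emeasure_density) (auto intro!: nn_integral_cong)
    also have "\<dots> = 1"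
      using nn_integral_eq_integral[OF D(1) D_nonneg] D(2) z by simp
    finally show "emeasure (P z) (space (P z)) = 1" .
  qed
  have AC_P: "absolutely_continuous Q (P z)" if [simp]: "z \<in> space PZ" for z
    unfolding P_eq by (rule absolutely_continuousI_density) measurable
  have P\<Theta>: "prob_space P\<Theta>" "sets P\<Theta> = sets Q" "absolutely_continuous Q P\<Theta>"
    using d(2) by (auto simp: prob_abs_cont_def)
  interpret P\<Theta>: prob_space P\<Theta> by (rule P\<Theta>(1))
  note [measurable_cong] = P\<Theta>(2)
  have P\<Theta>_eq: "P\<Theta> = PZ \<bind> P"
    unfolding P\<Theta>_def P_def[symmetric] by (rule marginal_eq_bind[OF kernel PZ.not_empty])
  have RN: "AE \<theta> in Q. RN_deriv Q (P z) \<theta> = ennreal (D z \<theta>)" if [simp]: "z \<in> space PZ" for z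
    using Q.RN_deriv_unique[of "\<lambda>\<theta>. ennreal (D z \<theta>)" "P z"] by (auto simp: P_eq)
  have deriv_RN: "AE \<theta> in Q. F (enn2real (RN_deriv Q (P z) \<theta>)) = - (\<beta> z + L z \<theta>) / lam"
    if z: "z \<in> space PZ" for z
    using RN[OF z] AE_D[OF z] by eventually_elim simp
  have L_nonneg: "0 \<le> L z \<theta>" for z \<theta>
    unfolding L_def emp_loss_def using loss by (auto intro!: divide_nonneg_nonneg sum_list_nonneg)
  have L_int: "integrable (P u) (L z)" if "z \<in> space PZ" "u \<in> space PZ" for z u
    using int1 that by (simp add: L_def)
  have L_meas[measurable]: "L z \<in> borel_measurable Q" if "z \<in> space PZ" for z
    using borel_measurable_integrable[OF L_int[OF that that]] by (simp cong: measurable_cong_sets add: P_sets)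
  have r_eq: "r z u = (\<integral>\<theta>. L z \<theta> \<partial>P u)" for z u
    by (simp add: r_def emp_risk_def L_def)
  have r_nonneg: "0 \<le> r z u" for z u
    unfolding r_eq by (simp add: L_nonneg integral_nonneg_AE)
  \<comment> \<open>Stationarity passes from \<open>Q\<close> to any \<open>N\<close> dominated by
    it, and it is affine in the loss with slope -1/lam. This serves both \<open>P z\<close> and
    \<open>P\<Theta>\<close>; the converse direction of the equivalence detects when the integral
    against \<open>P\<Theta>\<close> takes its default value.\<close>
  have F_RN_iff: "integrable N (\<lambda>\<theta>. F (enn2real (RN_deriv Q (P z) \<theta>))) \<longleftrightarrow> integrable N (L z)"
      "integrable N (L z) \<Longrightarrow>
        (\<integral>\<theta>. F (enn2real (RN_deriv Q (P z) \<theta>)) \<partial>N) = - (\<beta> z + (\<integral>\<theta>. L z \<theta> \<partial>N)) / lam"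
    if z[simp]: "z \<in> space PZ" and N: "prob_space N" "sets N = sets Q" "absolutely_continuous Q N" for z N
  proof -
    interpret N: prob_space N by (rule N(1))
    note [measurable_cong] = N(2)
    have ae: "AE \<theta> in N. F (enn2real (RN_deriv Q (P z) \<theta>)) = - (\<beta> z + L z \<theta>) / lam"
      using absolutely_continuous_AE[OF N(2) N(3) deriv_RN[OF z]] .
    have "integrable N (\<lambda>\<theta>. F (enn2real (RN_deriv Q (P z) \<theta>))) \<longleftrightarrow> integrable N (\<lambda>\<theta>. - (\<beta> z + L z \<theta>) / lam)"
      by (intro integrable_cong_AE ae) measurable
    also have "\<dots> \<longleftrightarrow> integrable N (L z)"
    proof
      assume "integrable N (\<lambda>\<theta>. - (\<beta> z + L z \<theta>) / lam)"
      then have "integrable N (\<lambda>\<theta>. - lam * (- (\<beta> z + L z \<theta>) / lam) - \<beta> z)"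
        by (intro Bochner_Integration.integrable_diff integrable_mult_right) auto
      then show "integrable N (L z)" using lam by (simp add: field_simps)
    qed auto
    finally show "integrable N (\<lambda>\<theta>. F (enn2real (RN_deriv Q (P z) \<theta>))) \<longleftrightarrow> integrable N (L z)" .
    assume LN: "integrable N (L z)"
    have "(\<integral>\<theta>. F (enn2real (RN_deriv Q (P z) \<theta>)) \<partial>N) = (\<integral>\<theta>. - (\<beta> z + L z \<theta>) / lam \<partial>N)"
      by (intro integral_cong_AE ae) measurable
    also have "\<dots> = - (\<beta> z + (\<integral>\<theta>. L z \<theta> \<partial>N)) / lam"
      using LN by (simp add: N.prob_space)
    finally show "(\<integral>\<theta>. F (enn2real (RN_deriv Q (P z) \<theta>)) \<partial>N) = - (\<beta> z + (\<integral>\<theta>. L z \<theta> \<partial>N)) / lam" .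
  qed
  have A: "A z = - (\<beta> z + r z z) / lam" if z: "z \<in> space PZ" for z
    unfolding A_def deriv_F r_eq
    by (rule F_RN_iff(2)[OF z P_prob[OF z] P_sets AC_P[OF z] L_int[OF z z]])
  \<comment> \<open>The value 0 is the default of the Bochner integral for a non-integrable
    function.\<close>
  have B: "B z = (if integrable P\<Theta> (L z) then - (\<beta> z + (\<integral>\<theta>. L z \<theta> \<partial>P\<Theta>)) / lam else 0)"
    if z: "z \<in> space PZ" for z
    unfolding B_def deriv_F using F_RN_iff[OF z P\<Theta>]
    by (auto simp: not_integrable_integral_eq)

  \<comment> \<open>The loss integrated against the marginal\<close>
  have r_int: "integrable (PZ \<Otimes>\<^sub>M PZ) (\<lambda>(z, u). r z u)"
    using PP.integrable_product_swap[OF int2] by (simp add: r_def)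
  have r_meas[measurable]: "(\<lambda>(z, u). r z u) \<in> borel_measurable (PZ \<Otimes>\<^sub>M PZ)"
    using r_int by (rule borel_measurable_integrable)
  \<comment> \<open>The risk of the marginal with values in [0, \<infinity>]: measurable in
    \<open>z\<close> without exception, and finite exactly when the loss is integrable against
    \<open>P\<Theta>\<close>.\<close>
  define s where "s z = (\<integral>\<^sup>+u. ennreal (r z u) \<partial>PZ)" for z
  have [measurable]: "s \<in> borel_measurable PZ"
    unfolding s_def by measurable
  have L_P\<Theta>: "(\<integral>\<^sup>+\<theta>. ennreal (L z \<theta>) \<partial>P\<Theta>) = s z" if z[simp]: "z \<in> space PZ" for z
  proof -
    have "(\<integral>\<^sup>+\<theta>. ennreal (L z \<theta>) \<partial>P\<Theta>) = (\<integral>\<^sup>+u. \<integral>\<^sup>+\<theta>. ennreal (L z \<theta>) \<partial>P u \<partial>PZ)"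
      unfolding P\<Theta>_eq by (rule nn_integral_bind[OF _ kernel]) measurable
    also have "\<dots> = s z"
      unfolding s_def r_eq
      by (intro nn_integral_cong nn_integral_eq_integral L_int) (auto simp: L_nonneg)
    finally show ?thesis .
  qed
  have L_P\<Theta>_iff: "integrable P\<Theta> (L z) \<longleftrightarrow> s z < \<infinity>" and L_P\<Theta>_eq: "(\<integral>\<theta>. L z \<theta> \<partial>P\<Theta>) = enn2real (s z)"
    if z[simp]: "z \<in> space PZ" for z
  proof -
    have [measurable]: "L z \<in> borel_measurable P\<Theta>" by measurable
    show "integrable P\<Theta> (L z) \<longleftrightarrow> s z < \<infinity>"
      by (simp add: integrable_iff_bounded L_nonneg L_P\<Theta>)
    show "(\<integral>\<theta>. L z \<theta> \<partial>P\<Theta>) = enn2real (s z)"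
      by (subst integral_eq_nn_integral) (auto simp: L_nonneg L_P\<Theta>)
  qed
  have s_eq: "s z < \<infinity>" "enn2real (s z) = (\<integral>u. r z u \<partial>PZ)"
    if "integrable PZ (r z)" for z
    using nn_integral_eq_integral[OF that] r_nonneg
    by (auto simp: s_def Bochner_Integration.integral_nonneg)

  \<comment> \<open>The Bochner integral of a non-measurable function is 0, so the integrand has to be
    measurable also on the null set of datasets whose loss is not integrable w.r.t. the marginal.\<close>
  have A_meas: "A \<in> borel_measurable PZ"
  proof -
    \<comment> \<open>By change of variables \<open>A z\<close> is the integral of x F(x) against
      the law of \<open>D z\<close> under \<open>Q\<close>, so it depends on \<open>z\<close> only
      through that law.\<close>
    define \<mu> where "\<mu> z = distr Q borel (D z)" for z
    have [measurable]: "\<mu> \<in> PZ \<rightarrow>\<^sub>M subprob_algebra borel"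
      unfolding \<mu>_def
      by (rule measurable_prob_algebraD, rule measurable_distr_density[OF Q(1,3) kernel D(1) D_nonneg P_eq])
    \<comment> \<open>Split into two nonnegative integrals, since these are measurable along a
      kernel.\<close>
    have "A z = enn2real (\<integral>\<^sup>+x. ennreal (x * F x) \<partial>\<mu> z) - enn2real (\<integral>\<^sup>+x. ennreal (- (x * F x)) \<partial>\<mu> z)"
      if z[simp]: "z \<in> space PZ" for z
    proof -
      have ae: "AE \<theta> in P z. F (enn2real (RN_deriv Q (P z) \<theta>)) = F (D z \<theta>)"
        using P_sets AC_P[OF z]
      proof (rule absolutely_continuous_AE)
        show "AE \<theta> in Q. F (enn2real (RN_deriv Q (P z) \<theta>)) = F (D z \<theta>)"
          using RN[OF z] D_nonneg[OF z] by eventually_elim simp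
      qed
      have 1: "integrable (P z) (\<lambda>\<theta>. F (D z \<theta>))"
        using F_RN_iff(1)[OF z P_prob[OF z] P_sets AC_P[OF z]] L_int[OF z z]
        by (subst integrable_cong_AE[OF _ _ ae, symmetric]) auto
      have 2: "A z = (\<integral>\<theta>. F (D z \<theta>) \<partial>P z)"
        unfolding A_def deriv_F by (intro integral_cong_AE ae) measurable
      have "integrable Q (\<lambda>\<theta>. D z \<theta> * F (D z \<theta>))"
        using 1 D_nonneg[OF z] unfolding P_eq by (subst (asm) integrable_density) auto
      then have 3: "integrable (\<mu> z) (\<lambda>x. x * F x)"
        unfolding \<mu>_def by (subst integrable_distr_eq) auto
      have "A z = (\<integral>\<theta>. D z \<theta> * F (D z \<theta>) \<partial>Q)"
        unfolding 2 P_eq using D_nonneg[OF z] by (subst integral_density) auto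
      also have "\<dots> = (\<integral>x. x * F x \<partial>\<mu> z)"
        unfolding \<mu>_def by (subst integral_distr) auto
      also have "\<dots> = enn2real (\<integral>\<^sup>+x. ennreal (x * F x) \<partial>\<mu> z) - enn2real (\<integral>\<^sup>+x. ennreal (- (x * F x)) \<partial>\<mu> z)"
        by (rule real_lebesgue_integral_def[OF 3])
      finally show ?thesis .
    qed
    moreover have "(\<lambda>z. enn2real (\<integral>\<^sup>+x. ennreal (x * F x) \<partial>\<mu> z) - enn2real (\<integral>\<^sup>+x. ennreal (- (x * F x)) \<partial>\<mu> z)) \<in> borel_measurable PZ"
      by measurable
    ultimately show ?thesis by (simp cong: measurable_cong)
  qed

  have r_diag[measurable]: "(\<lambda>z. r z z) \<in> borel_measurable PZ"
    using int3 by (simp add: r_def borel_measurable_integrable)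
  \<comment> \<open>If \<open>s z\<close> is finite, the constants \<open>\<beta> z\<close> cancel.
    Otherwise \<open>B z\<close> is 0 by default and \<open>A z\<close> alone remains, which is
    where \<open>A_meas\<close> enters.\<close>
  have AB: "A z - B z = (if s z < \<infinity> then (enn2real (s z) - r z z) / lam else A z)"
    if z: "z \<in> space PZ" for z
    using A[OF z] B[OF z] L_P\<Theta>_iff[OF z] L_P\<Theta>_eq[OF z] by (auto simp: diff_divide_distrib add_divide_distrib)
  have "(\<lambda>z. if s z < \<infinity> then (enn2real (s z) - r z z) / lam else A z) \<in> borel_measurable PZ"
    using A_meas by measurable
  then have AB_meas: "(\<lambda>z. A z - B z) \<in> borel_measurable PZ"
    using AB by (simp cong: measurable_cong)

  \<comment> \<open>Fubini and the final computation\<close>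
  have r_fst: "AE z in PZ. integrable PZ (r z)" and r_Fubini: "integrable PZ (\<lambda>z. \<integral>u. r z u \<partial>PZ)"
    using PP.AE_integrable_fst'[OF r_int] PP.integrable_fst'[OF r_int] by simp_all
  have r_snd: "AE z in PZ. integrable PZ (\<lambda>u. r u z)" and r_Fubini': "integrable PZ (\<lambda>z. \<integral>u. r u z \<partial>PZ)"
    using PP.AE_integrable_fst'[OF int2] PP.integrable_fst'[OF int2] by (simp_all add: r_def)
  have r_diag_int: "integrable PZ (\<lambda>z. r z z)"
    using int3 by (simp add: r_def)

  have "gen_error loss h P PZ = (\<integral>z. (\<integral>u. r u z - r z z \<partial>PZ) \<partial>PZ)"
    by (simp add: gen_error_def r_def)
  also have "\<dots> = (\<integral>z. (\<integral>u. r u z \<partial>PZ) - r z z \<partial>PZ)"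
  proof (rule integral_cong_AE)
    show "AE z in PZ. (\<integral>u. r u z - r z z \<partial>PZ) = (\<integral>u. r u z \<partial>PZ) - r z z"
      using r_snd by eventually_elim (simp add: PZ.prob_space)
  qed measurable
  also have "\<dots> = (\<integral>z. \<integral>u. r u z \<partial>PZ \<partial>PZ) - (\<integral>z. r z z \<partial>PZ)"
    by (rule Bochner_Integration.integral_diff[OF r_Fubini' r_diag_int])
  \<comment> \<open>Training and test dataset are independent with the same law, so their roles may
    be exchanged; afterwards the inner integral is the risk of the marginal on the dataset
    \<open>z\<close>.\<close>
  also have "(\<integral>z. \<integral>u. r u z \<partial>PZ \<partial>PZ) = (\<integral>z. \<integral>u. r z u \<partial>PZ \<partial>PZ)"
    by (rule PP.Fubini_integral[OF r_int])
  also have "\<dots> - (\<integral>z. r z z \<partial>PZ) = (\<integral>z. (\<integral>u. r z u \<partial>PZ) - r z z \<partial>PZ)"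
    by (rule Bochner_Integration.integral_diff[OF r_Fubini r_diag_int, symmetric])
  also have "\<dots> = (\<integral>z. lam * (A z - B z) \<partial>PZ)"
  proof (rule integral_cong_AE)
    \<comment> \<open>For almost every \<open>z\<close> the function \<open>r z\<close> is
      integrable, so \<open>s z\<close> is finite and the default case of \<open>AB\<close> does not
      occur.\<close>
    show "AE z in PZ. (\<integral>u. r z u \<partial>PZ) - r z z = lam * (A z - B z)"
      using r_fst AE_space
    proof eventually_elim
      case (elim z)
      then show ?case using AB[of z] s_eq[of z] lam by simp
    qed
  qed (use AB_meas in measurable)
  also have "\<dots> = lam * (\<integral>z. A z - B z \<partial>PZ)"
    by simp
  finally show ?thesis
    unfolding A_def B_def .
qed

end
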